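(* Let $e\ge 4$ be an integer. Then $e-1$ and $e+1$ are both prime (i.e., $(e-1,e+1)$ is a pair of twin primes) if and only if $$\rho(e)<\sqrt{\frac{e+\sqrt{e^2-4\left(e-1-\sqrt{e-1}\right)}}{2}}.$$
   Context: The spectral radius $\rho(G)$ is the largest eigenvalue of the adjacency matrix of $G$. For $e\ge 2$, $\rho(e)$ denotes the maximum of $\rho(G)$ over all bipartite graphs $G$ with $e$ edges that are not the union of a complete bipartite graph and (possibly zero) isolated vertices. *)

theory Defs
  imports
    Complex_Main
    "HOL-Computational_Algebra.Primes"
    "Jordan_Normal_Form.Spectral_Radius"
begin

text \<open>A finite simple graph is given by its number of vertices \<open>n\<close>, the vertices being
  \<open>0, \<dots>, n - 1\<close>, and its set \<open>E\<close> of edges, each a two-element set of vertices. Every finite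
  simple graph is isomorphic to one of this form.\<close>

definition simple_graph :: "nat \<Rightarrow> nat set set \<Rightarrow> bool" where
  "simple_graph n E \<longleftrightarrow> (\<forall>x\<in>E. x \<subseteq> {..<n} \<and> card x = 2)"

definition bipartite :: "nat \<Rightarrow> nat set set \<Rightarrow> bool" where
  "bipartite n E \<longleftrightarrow>
     (\<exists>A B. A \<union> B = {..<n} \<and> A \<inter> B = {} \<and> (\<forall>x\<in>E. \<exists>a\<in>A. \<exists>b\<in>B. x = {a, b}))"

text \<open>The union of a complete bipartite graph with parts \<open>A\<close>, \<open>B\<close> and (possibly zero) isolated
  vertices: these are the vertices outside \<open>A \<union> B\<close>.\<close>

definition complete_bipartite_with_isolated :: "nat \<Rightarrow> nat set set \<Rightarrow> bool" where
  "complete_bipartite_with_isolated n E \<longleftrightarrow>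
     (\<exists>A B. A \<noteq> {} \<and> B \<noteq> {} \<and> A \<union> B \<subseteq> {..<n} \<and> A \<inter> B = {} \<and>
        E = {{a, b} | a b. a \<in> A \<and> b \<in> B})"

definition adjacency_matrix :: "nat \<Rightarrow> nat set set \<Rightarrow> real mat" where
  "adjacency_matrix n E = mat n n (\<lambda>(i, j). if {i, j} \<in> E then 1 else 0)"

text \<open>The adjacency matrix is real symmetric, so for \<open>n > 0\<close> its set of real eigenvalues is
  finite and nonempty and contains all of its complex eigenvalues.\<close>

definition graph_spectral_radius :: "nat \<Rightarrow> nat set set \<Rightarrow> real" where
  "graph_spectral_radius n E = Max (spectrum (adjacency_matrix n E))"

text \<open>The number of vertices is unrestricted, but only finitely many values occur: apart from
  isolated vertices, which only contribute eigenvalues \<open>0\<close>, there are finitely many graphs with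
  \<open>e\<close> edges up to isomorphism. For \<open>e \<ge> 2\<close> there is at least one value, as \<open>e\<close> disjoint edges show,
  so \<open>Max\<close> is a genuine maximum.\<close>

definition max_spectral_radius :: "nat \<Rightarrow> real" where
  "max_spectral_radius e = Max {graph_spectral_radius n E | n E.
     simple_graph n E \<and> bipartite n E \<and> card E = e \<and> \<not> complete_bipartite_with_isolated n E}"

end

theory Submission
  imports Defs "HOL-Analysis.Convex"
begin

text \<open>Let \<open>M\<close> be the biadjacency matrix of a bipartite graph with \<open>e\<close> edges, and let \<open>S\<close> be the sum
  over the pairs of rows \<open>X\<close>, \<open>Y\<close> (as neighbourhoods) of the Gram determinant
  \<open>\<bar>X\<bar> \<bar>Y\<bar> - \<bar>X \<inter> Y\<bar>\<^sup>2\<close>. The Frobenius norm of the Gram matrix of the rows is \<open>sqrt (e\<^sup>2 - 2 S)\<close>, so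
  every eigenvalue \<open>k\<close> satisfies \<open>k\<^sup>4 \<le> e\<^sup>2 - 2 S\<close>, and \<open>S \<ge> e - 2\<close> already puts \<open>k\<close> below the
  threshold. If \<open>S < e - 2\<close> and the rows are not all equal, then there are exactly two distinct rows:
  with three of them, some pair contributes enough, and each further row \<open>X\<close> adds at least
  \<open>\<bar>X\<bar>\<close> to \<open>S\<close>. With two distinct rows, \<open>S < e - 2\<close> forces a complete bipartite graph minus an edge or
  plus a pendant edge, and then \<open>e + 1\<close> or \<open>e - 1\<close> is composite. Conversely, these two kinds of
  graphs are blow-ups of the path on four vertices, whose eigenvalues are explicit, and they reach
  the threshold.\<close>

subsection \<open>Gram determinants of families of sets\<close>

text \<open>This is the determinant of the 2 by 2 Gram matrix of the indicator vectors of
  \<open>X\<close> and \<open>Y\<close>. It is integer valued so that the subtraction is not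
  truncated.\<close>

definition gram :: "'a set \<Rightarrow> 'a set \<Rightarrow> int" where
  "gram X Y = int (card X) * int (card Y) - (int (card (X \<inter> Y)))\<^sup>2"

lemma gram_self [simp]: "gram X X = 0"
  by (simp add: gram_def power2_eq_square)

lemma gram_commute: "gram X Y = gram Y X"
  by (simp add: gram_def Int_commute mult.commute)

lemma card_split_Int_Diff:
  assumes "finite X"
  shows "int (card X) = int (card (X \<inter> Y)) + int (card (X - Y))"
  using card_Int_Diff[OF assms, of Y] by simp

text \<open>In the sizes of the three Venn regions the square cancels, leaving a polynomial with
  nonnegative coefficients; the bounds below become inequalities between nonnegative
  integers.\<close>

lemma gram_venn:
  assumes "finite X" "finite Y"
  defines "x \<equiv> int (card (X \<inter> Y))" and "y \<equiv> int (card (X - Y))" and "z \<equiv> int (card (Y - X))"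
  shows "gram X Y = x * y + x * z + y * z"
    and "int (card X) = x + y" and "int (card Y) = x + z"
proof -
  show X: "int (card X) = x + y" and Y: "int (card Y) = x + z"
    using card_split_Int_Diff[OF assms(1), of Y] card_split_Int_Diff[OF assms(2), of X]
    by (simp_all add: assms Int_commute)
  show "gram X Y = x * y + x * z + y * z"
    unfolding gram_def X Y by (simp add: x_def power2_eq_square algebra_simps)
qed

lemma card_diffs_pos:
  assumes "finite X" "finite Y" "X \<noteq> Y"
  shows "int (card (X - Y)) + int (card (Y - X)) \<ge> 1"
proof -
  have "card (X - Y) \<noteq> 0 \<or> card (Y - X) \<noteq> 0"
    using assms by auto
  thus ?thesis by linarith
qed

text \<open>The two bounds are meant to be added: of two rows differing from \<open>X\<close>, one
  contributes \<open>1\<close> and the other \<open>card X - 1\<close>.\<close>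

lemma gram_ge:
  assumes "finite X" "finite Y" "X \<noteq> {}" "Y \<noteq> {}" "X \<noteq> Y"
  shows "gram X Y \<ge> 1" and "gram X Y \<ge> int (card X) - 1"
proof -
  define x y z where "x = int (card (X \<inter> Y))" and "y = int (card (X - Y))" and "z = int (card (Y - X))"
  note v = gram_venn[OF assms(1,2), folded x_def y_def z_def]
  have "int (card X) \<ge> 1" "int (card Y) \<ge> 1"
    using assms by (simp_all add: Suc_le_eq card_gt_0_iff)
  hence p: "x + y \<ge> 1" "x + z \<ge> 1" using v by simp_all
  have yz: "y + z \<ge> 1" using card_diffs_pos[OF assms(1,2,5)] by (simp add: y_def z_def)
  have nn: "x \<ge> 0" "y \<ge> 0" "z \<ge> 0" by (simp_all add: x_def y_def z_def)
  show "gram X Y \<ge> int (card X) - 1"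
  proof (cases "z = 0")
    case True
    \<comment> \<open>Here \<open>Y\<close> lies inside \<open>X\<close>, so both factors are
      nonnegative; expanding gives \<open>x * y >= x + y - 1\<close>.\<close>
    hence "(x - 1) * (y - 1) \<ge> 0" using p yz nn by simp
    thus ?thesis using True by (simp add: v algebra_simps)
  next
    case False
    hence "x * z \<ge> x" "y * z \<ge> y" "x * y \<ge> 0" using nn by (simp_all add: mult_le_cancel_left1)
    thus ?thesis by (simp add: v)
  qed
  show "gram X Y \<ge> 1"
  proof (cases "x = 0")
    case True
    hence "y * z > 0" using p by simp
    thus ?thesis using True by (simp add: v)
  next
    case False
    hence "x * (y + z) > 0" using nn yz by (intro mult_pos_pos) auto
    moreover have "y * z \<ge> 0" using nn by simp
    ultimately show ?thesis by (simp add: v algebra_simps)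
  qed
qed

text \<open>The bound may fail for nested sets whose cardinalities differ by one.\<close>

lemma gram_ge_sum:
  assumes "finite X" "finite Y" "X \<noteq> {}" "Y \<noteq> {}" "X \<noteq> Y"
    and "card X \<noteq> Suc (card Y)" "card Y \<noteq> Suc (card X)"
  shows "gram X Y \<ge> int (card X) + int (card Y) - 2"
proof -
  define x y z where "x = int (card (X \<inter> Y))" and "y = int (card (X - Y))" and "z = int (card (Y - X))"
  note v = gram_venn[OF assms(1,2), folded x_def y_def z_def]
  have "int (card X) \<ge> 1" "int (card Y) \<ge> 1"
    using assms by (simp_all add: Suc_le_eq card_gt_0_iff)
  hence p: "x + y \<ge> 1" "x + z \<ge> 1" using v by simp_all
  have yz: "y + z \<ge> 1" using card_diffs_pos[OF assms(1,2,5)] by (simp add: y_def z_def)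
  have nn: "x \<ge> 0" "y \<ge> 0" "z \<ge> 0" by (simp_all add: x_def y_def z_def)
  \<comment> \<open>For \<open>y = 0\<close> the claim reads \<open>(x - 1) * (z - 2) >= 0\<close>,
    which can fail only at \<open>z = 1\<close>; this is excluded here, and likewise
    \<open>y = 1\<close> when \<open>z = 0\<close>.\<close>
  have ne: "y \<noteq> z + 1" "z \<noteq> y + 1" using assms(6,7) v by linarith+
  consider "x = 0" | "x \<ge> 1" "y = 0" | "x \<ge> 1" "z = 0" | "x \<ge> 1" "y \<ge> 1" "z \<ge> 1"
    using nn by linarith
  thus ?thesis
  proof cases
    case 1
    hence "(y - 1) * (z - 1) \<ge> 0" using p by simp
    thus ?thesis using 1 by (simp add: v algebra_simps)
  next
    case 2
    hence "(x - 1) * (z - 2) \<ge> 0" using ne yz by simp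
    thus ?thesis using 2 by (simp add: v algebra_simps)
  next
    case 3
    hence "(x - 1) * (y - 2) \<ge> 0" using ne yz by simp
    thus ?thesis using 3 by (simp add: v algebra_simps)
  next
    case 4
    hence "(x - 1) * (y - 1) \<ge> 0" "(x - 1) * (z - 1) \<ge> 0" "(y - 1) * (z - 1) \<ge> 0" by simp_all
    thus ?thesis using 4 by (simp add: v algebra_simps)
  qed
qed

text \<open>Ordered pairs are summed and the diagonal is zero, so this is \<open>2 * S\<close> for
  the \<open>S\<close> of the introduction; hence the factors \<open>2\<close> in the
  bounds.\<close>

definition gram_sum :: "('i \<Rightarrow> 'a set) \<Rightarrow> 'i set \<Rightarrow> int" where
  "gram_sum N I = (\<Sum>i\<in>I. \<Sum>j\<in>I. gram (N i) (N j))"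

lemma gram_sum_insert:
  assumes "finite I" "i \<notin> I"
  shows "gram_sum N (insert i I) = gram_sum N I + 2 * (\<Sum>j\<in>I. gram (N i) (N j))"
  using assms by (simp add: gram_sum_def sum.distrib gram_commute[of _ "N i"])

lemma gram_nonneg: "finite X \<Longrightarrow> finite Y \<Longrightarrow> gram X Y \<ge> 0"
  by (simp add: gram_venn(1))

lemma gram_sum_insert_ge:
  assumes "finite I" "i \<notin> I" "j \<in> I" "k \<in> I" "j \<noteq> k" "N j \<noteq> N i" "N k \<noteq> N i"
    and "\<And>l. l \<in> insert i I \<Longrightarrow> finite (N l) \<and> N l \<noteq> {}"
  shows "gram_sum N (insert i I) \<ge> gram_sum N I + 2 * int (card (N i))"
proof -
  have "int (card (N i)) \<le> gram (N i) (N j) + gram (N i) (N k)"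
  proof -
    have "gram (N i) (N j) \<ge> 1" "gram (N i) (N k) \<ge> int (card (N i)) - 1"
      using assms by (metis gram_ge insert_iff)+
    thus ?thesis by simp
  qed
  also have "\<dots> = (\<Sum>l\<in>{j, k}. gram (N i) (N l))" using assms(5) by simp
  also have "\<dots> \<le> (\<Sum>l\<in>I. gram (N i) (N l))"
    by (rule sum_mono2) (use assms gram_nonneg in auto)
  finally show ?thesis using assms by (simp add: gram_sum_insert)
qed

text \<open>A further row equals at most one of three distinct rows, so it differs from two others.
  By \<open>gram_sum_insert_ge\<close>, adding it raises the left side by at least twice its size,
  and the right side grows by exactly that.\<close>

lemma gram_sum_ge_extend:
  assumes "finite J" "I \<subseteq> J" "{i, j, k} \<subseteq> I" "N i \<noteq> N j" "N i \<noteq> N k" "N j \<noteq> N k"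
    and "\<And>l. l \<in> J \<Longrightarrow> finite (N l) \<and> N l \<noteq> {}"
    and "gram_sum N I \<ge> 2 * (int (\<Sum>l\<in>I. card (N l)) - 2)"
  shows "gram_sum N J \<ge> 2 * (int (\<Sum>l\<in>J. card (N l)) - 2)"
proof -
  have "finite I" using assms(1,2) finite_subset by blast
  have extend: "gram_sum N (I \<union> K) \<ge> 2 * (int (\<Sum>l\<in>I \<union> K. card (N l)) - 2)"
    if "finite K" "K \<subseteq> J - I" for K
    using that
  proof (induction K rule: finite_induct)
    case empty
    thus ?case using assms(8) by simp
  next
    case (insert m K)
    have m: "m \<notin> I \<union> K" "m \<in> J" using insert by auto
    have fin: "finite (I \<union> K)" using insert \<open>finite I\<close> by simp
    have ex: "\<exists>u v. u \<in> I \<union> K \<and> v \<in> I \<union> K \<and> u \<noteq> v \<and> N u \<noteq> N m \<and> N v \<noteq> N m"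
      using assms(3-6) by (metis UnCI insert_subset)
    then obtain u v where uv: "u \<in> I \<union> K" "v \<in> I \<union> K" "u \<noteq> v" "N u \<noteq> N m" "N v \<noteq> N m"
      by blast
    have "finite (N l) \<and> N l \<noteq> {}" if "l \<in> insert m (I \<union> K)" for l
      using that assms(2,7) insert by blast
    hence "gram_sum N (insert m (I \<union> K)) \<ge> gram_sum N (I \<union> K) + 2 * int (card (N m))"
      by (rule gram_sum_insert_ge[OF fin m(1) uv])
    moreover have "gram_sum N (I \<union> K) \<ge> 2 * (int (\<Sum>l\<in>I \<union> K. card (N l)) - 2)"
      using insert by auto
    ultimately show ?case using fin m by simp
  qed
  have "I \<union> (J - I) = J" using assms(2) by blast
  thus ?thesis using extend[of "J - I"] assms(1) by simp
qed

text \<open>Two of the three rows satisfy the size condition of \<open>gram_ge_sum\<close> and give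
  the initial bound; then the third row is added, and after it all the others.\<close>

lemma gram_sum_ge_three:
  assumes "finite J" "i \<in> J" "j \<in> J" "k \<in> J" "N i \<noteq> N j" "N i \<noteq> N k" "N j \<noteq> N k"
    and N: "\<And>l. l \<in> J \<Longrightarrow> finite (N l) \<and> N l \<noteq> {}"
  shows "gram_sum N J \<ge> 2 * (int (\<Sum>l\<in>J. card (N l)) - 2)"
proof -
  have main: "gram_sum N J \<ge> 2 * (int (\<Sum>l\<in>J. card (N l)) - 2)"
    if h: "i \<in> J" "j \<in> J" "k \<in> J" "N i \<noteq> N j" "N i \<noteq> N k" "N j \<noteq> N k"
      "card (N i) \<noteq> Suc (card (N j))" "card (N j) \<noteq> Suc (card (N i))" for i j k
  proof -
    have d: "i \<noteq> j" "k \<noteq> i" "k \<noteq> j" using h(4-6) by metis+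
    have "gram_sum N {i, j} = 2 * gram (N i) (N j)"
      using d(1) by (simp add: gram_sum_def gram_commute[of "N j"])
    moreover have "gram (N i) (N j) \<ge> int (card (N i)) + int (card (N j)) - 2"
      using N[OF h(1)] N[OF h(2)] h(4,7,8) by (intro gram_ge_sum) simp_all
    moreover have "gram_sum N (insert k {i, j}) \<ge> gram_sum N {i, j} + 2 * int (card (N k))"
    proof (rule gram_sum_insert_ge[where j = i and k = j])
      show "finite (N l) \<and> N l \<noteq> {}" if "l \<in> {k, i, j}" for l
        using that h(1-3) N by blast
    qed (use h(5,6) d in simp_all)
    ultimately have kij: "gram_sum N {k, i, j} \<ge> 2 * (int (\<Sum>l\<in>{k, i, j}. card (N l)) - 2)"
      using d by simp
    show ?thesis
      by (rule gram_sum_ge_extend[OF assms(1) _ _ h(4-6) N kij]) (use h(1-3) in simp_all)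
  qed
  \<comment> \<open>Parity: the cyclic differences of three sizes sum to zero, so they are not all
    odd, let alone all plus or minus one.\<close>
  consider "card (N i) \<noteq> Suc (card (N j))" "card (N j) \<noteq> Suc (card (N i))"
    | "card (N i) \<noteq> Suc (card (N k))" "card (N k) \<noteq> Suc (card (N i))"
    | "card (N j) \<noteq> Suc (card (N k))" "card (N k) \<noteq> Suc (card (N j))"
    by linarith
  thus ?thesis
    using main[of i j k] main[of i k j] main[of j k i] assms by cases auto
qed

text \<open>Here \<open>e\<close> counts the edges of the blow-up of a four-vertex path with part
  sizes \<open>a\<close>, \<open>b\<close>, \<open>c\<close>, \<open>d\<close>. For
  \<open>a = d = 1\<close> this is a complete bipartite graph minus an edge, and
  \<open>e + 1 = (b + 1) * (c + 1)\<close>. For \<open>a = b = 1\<close> it is one plus a pendant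
  edge, and \<open>e - 1 = c * (d + 1)\<close>. Apart from these and the reversed paths, the product
  is large enough.\<close>

lemma path_blowup_defect:
  fixes a b c d :: int
  assumes "a \<ge> 1" "b \<ge> 1" "c \<ge> 1" "d \<ge> 1"
  defines "e \<equiv> a * b + b * c + c * d"
  shows "a * b * c * d \<ge> e - 2 \<or> (\<exists>p q. p \<ge> 2 \<and> q \<ge> 2 \<and> (p * q = e + 1 \<or> p * q = e - 1))"
proof -
  \<comment> \<open>In \<open>one\<close> and \<open>two\<close> each variable is shifted by its
    lower bound, after which the difference of the two sides has only nonnegative
    coefficients.\<close>
  have one: "(b + 2) * (c + 1) * (d + 2) \<ge> (b + 2) + (b + 2) * (c + 1) + (c + 1) * (d + 2) - 2"
    if "b \<ge> 0" "c \<ge> 0" "d \<ge> 0" for b c d :: int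
    using that by (simp add: algebra_simps)
  have two: "(a + 2) * (b + 1) * (c + 1) * (d + 2) \<ge>
      (a + 2) * (b + 1) + (b + 1) * (c + 1) + (c + 1) * (d + 2) - 2"
    if "a \<ge> 0" "b \<ge> 0" "c \<ge> 0" "d \<ge> 0" for a b c d :: int
    using that by (simp add: algebra_simps)
  have "a = 1 \<or> a \<ge> 2" "b = 1 \<or> b \<ge> 2" "c = 1 \<or> c \<ge> 2" "d = 1 \<or> d \<ge> 2"
    using assms(1-4) by auto
  \<comment> \<open>Reversing the path swaps \<open>a\<close> with \<open>d\<close> and
    \<open>b\<close> with \<open>c\<close>: cases 5 to 7 mirror cases 2 to 4.\<close>
  then consider "a = 1" "d = 1" | "a = 1" "b = 1" "d \<ge> 2" "c = 1" | "a = 1" "b = 1" "d \<ge> 2" "c \<ge> 2"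
    | "a = 1" "b \<ge> 2" "d \<ge> 2" | "d = 1" "c = 1" "a \<ge> 2" "b = 1" | "d = 1" "c = 1" "a \<ge> 2" "b \<ge> 2"
    | "d = 1" "c \<ge> 2" "a \<ge> 2" | "a \<ge> 2" "d \<ge> 2"
    by blast
  thus ?thesis
  proof cases
    case 1
    hence "(b + 1) * (c + 1) = e + 1" by (simp add: e_def algebra_simps)
    moreover have "b + 1 \<ge> 2" "c + 1 \<ge> 2" using assms by simp_all
    ultimately show ?thesis by blast
  next
    case 3
    hence "c * (d + 1) = e - 1" by (simp add: e_def algebra_simps)
    moreover have "d + 1 \<ge> 2" using 3 by simp
    ultimately show ?thesis using 3 by blast
  next
    case 4
    thus ?thesis using one[of "b - 2" "c - 1" "d - 2"] assms by simp
  next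
    case 6
    hence "b * (a + 1) = e - 1" by (simp add: e_def algebra_simps)
    moreover have "a + 1 \<ge> 2" using 6 by simp
    ultimately show ?thesis using 6 by blast
  next
    case 7
    thus ?thesis using one[of "c - 2" "b - 1" "a - 2"] assms by (simp add: algebra_simps)
  next
    case 8
    thus ?thesis using two[of "a - 2" "b - 1" "c - 1" "d - 2"] assms by simp
  qed (simp_all add: e_def)
qed

text \<open>There are \<open>m\<close> rows \<open>X\<close> and \<open>n\<close> rows
  \<open>Y\<close>. Disjoint or properly overlapping sets always meet the bound. If one set contains
  the other, the two row classes and the two column classes form a path blow-up, and
  \<open>path_blowup_defect\<close> applies.\<close>

lemma gram_two_classes:
  fixes m n :: int
  assumes "finite X" "finite Y" "X \<noteq> {}" "Y \<noteq> {}" "X \<noteq> Y" "m \<ge> 1" "n \<ge> 1"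
  defines "e \<equiv> m * int (card X) + n * int (card Y)"
  shows "m * n * gram X Y \<ge> e - 2 \<or> (\<exists>p q. p \<ge> 2 \<and> q \<ge> 2 \<and> (p * q = e + 1 \<or> p * q = e - 1))"
proof -
  define x y z where "x = int (card (X \<inter> Y))" and "y = int (card (X - Y))" and "z = int (card (Y - X))"
  note v = gram_venn[OF assms(1,2), folded x_def y_def z_def]
  have "int (card X) \<ge> 1" "int (card Y) \<ge> 1"
    using assms by (simp_all add: Suc_le_eq card_gt_0_iff)
  hence p: "x + y \<ge> 1" "x + z \<ge> 1" using v by simp_all
  have yz: "y + z \<ge> 1" using card_diffs_pos[OF assms(1,2,5)] by (simp add: y_def z_def)
  have nn: "x \<ge> 0" "y \<ge> 0" "z \<ge> 0" by (simp_all add: x_def y_def z_def)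
  consider "x = 0" "y \<ge> 1" "z \<ge> 1" | "x \<ge> 1" "y = 0" "z \<ge> 1" | "x \<ge> 1" "y \<ge> 1" "z = 0"
    | "x \<ge> 1" "y \<ge> 1" "z \<ge> 1"
    using nn p yz by linarith
  thus ?thesis
  proof cases
    case 1
    have "m * y \<ge> 1" "n * z \<ge> 1" using 1 assms by (simp_all add: int_one_le_iff_zero_less)
    hence "(m * y - 1) * (n * z - 1) \<ge> 0" by simp
    thus ?thesis using 1 by (simp add: e_def v algebra_simps)
  next
    case 2
    thus ?thesis
      using path_blowup_defect[of m x n z] assms(6,7) by (simp add: e_def v algebra_simps)
  next
    case 3
    thus ?thesis
      using path_blowup_defect[of n x m y] assms(6,7) by (simp add: e_def v algebra_simps)
  next
    case 4
    have expand: "(m + 1) * (n + 1) * ((x + 1) * (y + 1) + (x + 1) * (z + 1) + (y + 1) * (z + 1))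
        \<ge> (m + 1) * ((x + 1) + (y + 1)) + (n + 1) * ((x + 1) + (z + 1)) - 2"
      if "m \<ge> 0" "n \<ge> 0" "x \<ge> 0" "y \<ge> 0" "z \<ge> 0" for m n x y z :: int
      using that by (simp add: algebra_simps)
    have "m * n * (x * y + x * z + y * z) \<ge> m * (x + y) + n * (x + z) - 2"
      using expand[of "m - 1" "n - 1" "x - 1" "y - 1" "z - 1"] 4 assms(6,7) by simp
    thus ?thesis by (simp add: e_def v)
  qed
qed

text \<open>Three distinct rows give the first alternative. Otherwise the rows fall into two classes
  \<open>U\<close> and \<open>V\<close>, and only mixed pairs contribute, each in both
  orders.\<close>

lemma gram_sum_ge:
  assumes fin: "finite I"
    and N: "\<And>i. i \<in> I \<Longrightarrow> finite (N i) \<and> N i \<noteq> {}"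
    and uv: "u \<in> I" "v \<in> I" "N u \<noteq> N v"
  defines "e \<equiv> int (\<Sum>i\<in>I. card (N i))"
  shows "gram_sum N I \<ge> 2 * (e - 2) \<or> (\<exists>p q. p \<ge> 2 \<and> q \<ge> 2 \<and> (p * q = e + 1 \<or> p * q = e - 1))"
proof (cases "\<exists>w\<in>I. N w \<noteq> N u \<and> N w \<noteq> N v")
  case True
  then obtain w where "w \<in> I" "N w \<noteq> N u" "N w \<noteq> N v" by blast
  thus ?thesis
    using gram_sum_ge_three[OF fin uv(1,2) _ uv(3)] N unfolding e_def by metis
next
  case False
  define U V where "U = {i \<in> I. N i = N u}" and "V = {i \<in> I. N i = N v}"
  have UV: "I = U \<union> V" "U \<inter> V = {}" "finite U" "finite V" "u \<in> U" "v \<in> V"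
    using False fin uv by (auto simp: U_def V_def)
  have split: "(\<Sum>i\<in>I. g (N i)) = int (card U) * g (N u) + int (card V) * g (N v)"
    for g :: "_ \<Rightarrow> int"
  proof -
    have "(\<Sum>i\<in>I. g (N i)) = (\<Sum>i\<in>U. g (N i)) + (\<Sum>i\<in>V. g (N i))"
      unfolding UV(1) using UV by (intro sum.union_disjoint) auto
    also have "(\<Sum>i\<in>U. g (N i)) = (\<Sum>i\<in>U. g (N u))" by (intro sum.cong) (auto simp: U_def)
    also have "(\<Sum>i\<in>V. g (N i)) = (\<Sum>i\<in>V. g (N v))" by (intro sum.cong) (auto simp: V_def)
    finally show ?thesis by simp
  qed
  have e: "e = int (card U) * int (card (N u)) + int (card V) * int (card (N v))"
    unfolding e_def using split[of "\<lambda>X. int (card X)"] by simp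
  have "gram_sum N I = (\<Sum>i\<in>I. int (card U) * gram (N i) (N u) + int (card V) * gram (N i) (N v))"
    unfolding gram_sum_def by (intro sum.cong refl split)
  also have "\<dots> = 2 * (int (card U) * int (card V) * gram (N u) (N v))"
    using split[of "\<lambda>X. int (card U) * gram X (N u) + int (card V) * gram X (N v)"]
    by (simp add: gram_commute[of "N v"])
  finally have g: "gram_sum N I = 2 * (int (card U) * int (card V) * gram (N u) (N v))" .
  have "int (card U) \<ge> 1" "int (card V) \<ge> 1"
    using UV by (auto simp: Suc_le_eq card_gt_0_iff)
  thus ?thesis
    using gram_two_classes[of "N u" "N v" "int (card U)" "int (card V)"] N uv
    unfolding g e by auto
qed

subsection \<open>Eigenvalues of adjacency matrices\<close>

lemma adjacency_matrix_carrier [simp]: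
  "adjacency_matrix n E \<in> carrier_mat n n"
  by (simp add: adjacency_matrix_def)

text \<open>The field is arbitrary so that this serves both for a complex eigenvalue and for the
  real one derived from it.\<close>

lemma eigenvalue_mat_iff:
  fixes f :: "nat \<times> nat \<Rightarrow> 'a::field"
  shows "eigenvalue (mat n n f) k \<longleftrightarrow>
    (\<exists>x. (\<exists>i<n. x i \<noteq> 0) \<and> (\<forall>i<n. (\<Sum>j<n. f (i, j) * x j) = k * x i))"
proof
  assume "eigenvalue (mat n n f) k"
  then obtain v where v: "v \<in> carrier_vec n" "v \<noteq> 0\<^sub>v n" "mat n n f *\<^sub>v v = k \<cdot>\<^sub>v v"
    by (auto simp: eigenvalue_def eigenvector_def)
  have "\<exists>i<n. v $ i \<noteq> 0" using v(1,2) by (metis carrier_vecD eq_vecI index_zero_vec)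
  moreover have "(\<Sum>j<n. f (i, j) * v $ j) = k * v $ i" if "i < n" for i
  proof -
    have "(mat n n f *\<^sub>v v) $ i = (\<Sum>j<n. f (i, j) * v $ j)"
      using that v(1) by (simp add: scalar_prod_def lessThan_atLeast0)
    thus ?thesis using that v by simp
  qed
  ultimately show "\<exists>x. (\<exists>i<n. x i \<noteq> 0) \<and> (\<forall>i<n. (\<Sum>j<n. f (i, j) * x j) = k * x i)" by blast
next
  assume "\<exists>x. (\<exists>i<n. x i \<noteq> 0) \<and> (\<forall>i<n. (\<Sum>j<n. f (i, j) * x j) = k * x i)"
  then obtain x where x: "\<exists>i<n. x i \<noteq> 0" "\<And>i. i < n \<Longrightarrow> (\<Sum>j<n. f (i, j) * x j) = k * x i" by blast
  have "eigenvector (mat n n f) (vec n x) k"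
    unfolding eigenvector_def
  proof (intro conjI)
    show "vec n x \<noteq> 0\<^sub>v (dim_row (mat n n f))"
      using x(1) by (metis dim_row_mat(1) index_vec index_zero_vec(1))
    show "mat n n f *\<^sub>v vec n x = k \<cdot>\<^sub>v vec n x"
      using x(2) by (intro eq_vecI) (simp_all add: scalar_prod_def lessThan_atLeast0)
  qed simp
  thus "eigenvalue (mat n n f) k" by (auto simp: eigenvalue_def)
qed

lemma spectrum_adjacency_matrix_iff:
  "k \<in> spectrum (adjacency_matrix n E) \<longleftrightarrow>
    (\<exists>x. (\<exists>i<n. x i \<noteq> 0) \<and> (\<forall>i<n. (\<Sum>j | j < n \<and> {i, j} \<in> E. x j) = k * x i))"
proof -
  have "(\<Sum>j<n. (if {i, j} \<in> E then 1 else 0) * x j) = (\<Sum>j | j < n \<and> {i, j} \<in> E. x j)"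
    for i and x :: "nat \<Rightarrow> real"
    by (simp add: sum.If_cases if_distrib[of "\<lambda>y. y * _"] cong: if_cong)
      (intro sum.cong, auto)
  thus ?thesis
    unfolding spectrum_def adjacency_matrix_def mem_Collect_eq eigenvalue_mat_iff by simp
qed

lemma finite_spectrum_adjacency_matrix [simp]: "finite (spectrum (adjacency_matrix n E))"
  by (rule card_finite_spectrum[OF adjacency_matrix_carrier])

text \<open>A complex eigenvalue is real since the Hermitian form of a real symmetric matrix is real;
  the real or the imaginary part of an eigenvector is then a real eigenvector.\<close>

lemma spectrum_symmetric_mat_nonempty:
  fixes f :: "nat \<times> nat \<Rightarrow> real"
  assumes "n > 0" and sym: "\<And>i j. f (i, j) = f (j, i)"
  shows "spectrum (mat n n f) \<noteq> {}"
proof -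
  have "spectrum (mat n n (\<lambda>p. complex_of_real (f p))) \<noteq> {}"
    by (rule spectrum_non_empty[of _ n]) (use assms in auto)
  then obtain \<mu> x where x: "\<exists>i<n. x i \<noteq> (0::complex)"
    and eq: "\<And>i. i < n \<Longrightarrow> (\<Sum>j<n. complex_of_real (f (i, j)) * x j) = \<mu> * x i"
    unfolding spectrum_def by (auto simp: eigenvalue_mat_iff)
  define Q where "Q = (\<Sum>i<n. \<Sum>j<n. cnj (x i) * (complex_of_real (f (i, j)) * x j))"
  define s where "s = (\<Sum>i<n. (cmod (x i))\<^sup>2)"
  have "Q = (\<Sum>i<n. cnj (x i) * (\<mu> * x i))"
    unfolding Q_def by (intro sum.cong refl) (simp add: eq flip: sum_distrib_left)
  also have "\<dots> = (\<Sum>i<n. \<mu> * complex_of_real ((cmod (x i))\<^sup>2))"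
    by (intro sum.cong refl) (simp only: complex_norm_square mult_ac)
  also have "\<dots> = \<mu> * complex_of_real s"
    by (simp add: s_def sum_distrib_left)
  finally have Q: "Q = \<mu> * complex_of_real s" .
  have "cnj Q = (\<Sum>i<n. \<Sum>j<n. cnj (x j) * (complex_of_real (f (j, i)) * x i))"
    unfolding Q_def by (simp add: sym mult_ac)
  also have "\<dots> = Q" unfolding Q_def by (rule sum.swap)
  finally have "cnj \<mu> * complex_of_real s = \<mu> * complex_of_real s" using Q by simp
  moreover have "s > 0"
    unfolding s_def using x by (auto intro!: sum_pos2)
  ultimately have "cnj \<mu> = \<mu>" by simp
  hence mu: "\<mu> = complex_of_real (Re \<mu>)" by (simp add: complex_eq_iff)
  have Re: "(\<Sum>j<n. f (i, j) * Re (x j)) = Re \<mu> * Re (x i)"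
    and Im: "(\<Sum>j<n. f (i, j) * Im (x j)) = Re \<mu> * Im (x i)" if "i < n" for i
    using arg_cong[OF eq[OF that], of Re] arg_cong[OF eq[OF that], of Im]
    by (subst (asm) (1 2) mu; simp)+
  have "\<exists>y. (\<exists>i<n. y i \<noteq> 0) \<and> (\<forall>i<n. (\<Sum>j<n. f (i, j) * y j) = Re \<mu> * y i)"
  proof (cases "\<exists>i<n. Re (x i) \<noteq> 0")
    case True
    thus ?thesis using Re by (intro exI[of _ "\<lambda>i. Re (x i)"]) simp
  next
    case False
    hence "\<exists>i<n. Im (x i) \<noteq> 0" using x by (auto simp: complex_eq_iff)
    thus ?thesis using Im by (intro exI[of _ "\<lambda>i. Im (x i)"]) simp
  qed
  thus ?thesis by (auto simp: spectrum_def eigenvalue_mat_iff)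
qed

lemma graph_spectral_radius_in_spectrum:
  assumes "n > 0"
  shows "graph_spectral_radius n E \<in> spectrum (adjacency_matrix n E)"
  unfolding graph_spectral_radius_def
proof (rule Max_in)
  show "spectrum (adjacency_matrix n E) \<noteq> {}"
    unfolding adjacency_matrix_def
    by (rule spectrum_symmetric_mat_nonempty[OF assms]) (simp add: insert_commute)
qed simp

text \<open>The \<open>e\<close> edges cover at most \<open>2 * e\<close> vertices, and an
  eigenvector for \<open>k \<noteq> 0\<close> vanishes at isolated vertices, so it survives the
  relabelling of the covered vertices. This bounds the number of possible eigenvalues independently
  of \<open>n\<close>.\<close>

lemma nonzero_eigenvalue_relabel:
  assumes G: "simple_graph n E" and e: "card E = e" "finite E"
    and k: "k \<in> spectrum (adjacency_matrix n E)" "k \<noteq> 0"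
  shows "\<exists>F \<in> Pow (Pow {..<2 * e}). k \<in> spectrum (adjacency_matrix (2 * e) F)"
proof -
  obtain x where x: "\<exists>i<n. x i \<noteq> 0"
    and eq: "\<And>i. i < n \<Longrightarrow> (\<Sum>j | j < n \<and> {i, j} \<in> E. x j) = k * x i"
    using k(1) unfolding spectrum_adjacency_matrix_iff by blast
  define V where "V = \<Union>E"
  have E: "\<And>p. p \<in> E \<Longrightarrow> p \<subseteq> {..<n} \<and> card p = 2" using G by (auto simp: simple_graph_def)
  have V: "V \<subseteq> {..<n}" using E by (auto simp: V_def)
  have "card V \<le> (\<Sum>p\<in>E. card p)" unfolding V_def by (rule card_Union_le_sum_card)
  also have "\<dots> = 2 * e" using E e(1) by simp
  finally have "card V \<le> card {..<2 * e}" by simp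
  then obtain g where g: "g ` V \<subseteq> {..<2 * e}" "inj_on g V"
    using card_le_inj[of V "{..<2 * e}"] finite_subset[OF V] by auto
  have inV: "i \<in> V" "j \<in> V" if "{i, j} \<in> E" for i j using that by (auto simp: V_def)
  define F where "F = (`) g ` E"
  define y where "y u = (if u \<in> g ` V then x (inv_into V g u) else 0)" for u
  have y_g: "y (g i) = x i" if "i \<in> V" for i using that g(2) by (simp add: y_def)
  have F_iff: "{g i, u} \<in> F \<longleftrightarrow> (\<exists>j. u = g j \<and> {i, j} \<in> E)" if i: "i \<in> V" for i u
  proof
    assume "{g i, u} \<in> F"
    then obtain p where p: "p \<in> E" "{g i, u} = g ` p" by (auto simp: F_def)
    obtain a b where ab: "p = {a, b}" using E[OF p(1)] by (auto simp: card_2_iff)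
    have "a \<in> V" "b \<in> V" using p ab by (auto simp: V_def)
    moreover have "g i = g a \<and> u = g b \<or> g i = g b \<and> u = g a"
      using p(2) by (auto simp: ab doubleton_eq_iff)
    ultimately show "\<exists>j. u = g j \<and> {i, j} \<in> E"
      using inj_onD[OF g(2)] i p(1) ab by (metis insert_commute)
  next
    assume "\<exists>j. u = g j \<and> {i, j} \<in> E"
    then obtain j where "u = g j" "{i, j} \<in> E" by blast
    thus "{g i, u} \<in> F" unfolding F_def by (metis image_empty image_eqI image_insert)
  qed
  have F_V: "u \<in> g ` V" if uw: "{u, w} \<in> F" for u w
  proof -
    obtain p where "{u, w} = g ` p" "p \<in> E" using uw unfolding F_def by (rule imageE)
    thus ?thesis unfolding V_def by blast
  qed
  obtain i0 where i0: "i0 < n" "x i0 \<noteq> 0" using x by blast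
  have "i0 \<in> V"
  proof (rule ccontr)
    assume "i0 \<notin> V"
    hence no_nbr: "{j. j < n \<and> {i0, j} \<in> E} = {}" using inV by blast
    show False using eq[OF i0(1)] i0(2) k(2) unfolding no_nbr by simp
  qed
  hence "\<exists>u<2 * e. y u \<noteq> 0" using g(1) i0(2) y_g by (intro exI[of _ "g i0"]) auto
  moreover have "(\<Sum>w | w < 2 * e \<and> {u, w} \<in> F. y w) = k * y u" if "u < 2 * e" for u
  proof (cases "u \<in> g ` V")
    case True
    then obtain i where i: "i \<in> V" "u = g i" by blast
    have "{w. w < 2 * e \<and> {u, w} \<in> F} = g ` {j. j < n \<and> {i, j} \<in> E}"
    proof (intro equalityI subsetI)
      fix w assume "w \<in> {w. w < 2 * e \<and> {u, w} \<in> F}"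
      then obtain j where "w = g j" "{i, j} \<in> E" using F_iff[OF i(1)] i(2) by auto
      thus "w \<in> g ` {j. j < n \<and> {i, j} \<in> E}" using inV(2) V by blast
    next
      fix w assume "w \<in> g ` {j. j < n \<and> {i, j} \<in> E}"
      then obtain j where j: "w = g j" "{i, j} \<in> E" by blast
      hence "w < 2 * e" using inV(2) g(1) by blast
      thus "w \<in> {w. w < 2 * e \<and> {u, w} \<in> F}" using F_iff[OF i(1)] i(2) j by auto
    qed
    moreover have "inj_on g {j. j < n \<and> {i, j} \<in> E}"
      by (rule inj_on_subset[OF g(2)]) (use inV in auto)
    ultimately have "(\<Sum>w | w < 2 * e \<and> {u, w} \<in> F. y w) = (\<Sum>j | j < n \<and> {i, j} \<in> E. y (g j))"
      by (simp only: sum.reindex o_def)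
    also have "\<dots> = (\<Sum>j | j < n \<and> {i, j} \<in> E. x j)"
      by (intro sum.cong refl) (use inV y_g in auto)
    also have "\<dots> = k * y u" using eq[of i] i V y_g by auto
    finally show ?thesis .
  next
    case False
    hence no_nbr: "{w. w < 2 * e \<and> {u, w} \<in> F} = {}" using F_V by blast
    show ?thesis unfolding no_nbr using False by (simp add: y_def)
  qed
  ultimately have "k \<in> spectrum (adjacency_matrix (2 * e) F)"
    unfolding spectrum_adjacency_matrix_iff by blast
  moreover have "F \<in> Pow (Pow {..<2 * e})" using g(1) by (auto simp: F_def V_def)
  ultimately show ?thesis by blast
qed

lemma simple_graph_pos:
  assumes "simple_graph n E" "E \<noteq> {}"
  shows "n > 0"
proof -
  obtain p where "p \<in> E" using assms(2) by blast
  hence "p \<subseteq> {..<n}" "card p = 2" using assms(1) by (auto simp: simple_graph_def)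
  thus ?thesis by (cases n) auto
qed

definition radii :: "nat \<Rightarrow> real set" where
  "radii e = {graph_spectral_radius n E | n E. simple_graph n E \<and> bipartite n E \<and> card E = e \<and>
     \<not> complete_bipartite_with_isolated n E}"

text \<open>This makes \<open>Max\<close> meaningful: each nonzero radius is an eigenvalue for one
  of finitely many edge sets on \<open>2 * e\<close> vertices.\<close>

lemma finite_radii:
  assumes "e > 0"
  shows "finite (radii e)"
proof (rule finite_subset)
  show "radii e \<subseteq> {0} \<union> (\<Union>F \<in> Pow (Pow {..<2 * e}). spectrum (adjacency_matrix (2 * e) F))"
  proof
    fix k assume "k \<in> radii e"
    then obtain n E where nE: "simple_graph n E" "card E = e" "k = graph_spectral_radius n E"
      by (auto simp: radii_def)
    have "finite E" "E \<noteq> {}" using nE(2) assms by (auto simp: card_gt_0_iff)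
    hence "n > 0" using simple_graph_pos nE(1) by blast
    thus "k \<in> {0} \<union> (\<Union>F \<in> Pow (Pow {..<2 * e}). spectrum (adjacency_matrix (2 * e) F))"
      using nonzero_eigenvalue_relabel[OF nE(1,2) \<open>finite E\<close>]
        graph_spectral_radius_in_spectrum[of n E] nE(3) by blast
  qed
qed auto

subsection \<open>Upper bound\<close>

definition nbrs :: "nat \<Rightarrow> nat set set \<Rightarrow> nat \<Rightarrow> nat set" where
  "nbrs n E i = {j. j < n \<and> {i, j} \<in> E}"

lemma finite_nbrs [simp]: "finite (nbrs n E i)"
  by (simp add: nbrs_def)

lemma bipartite_edge_cases:
  assumes "\<forall>p\<in>E. \<exists>a\<in>A. \<exists>b\<in>B. p = {a, b}" "{u, v} \<in> E"
  shows "u \<in> A \<and> v \<in> B \<or> v \<in> A \<and> u \<in> B"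
proof -
  obtain a b where "a \<in> A" "b \<in> B" "{u, v} = {a, b}" using bspec[OF assms] by blast
  thus ?thesis by (auto simp: doubleton_eq_iff)
qed

text \<open>The square of the adjacency matrix, restricted to one side of the bipartition, is the Gram
  matrix of the neighbourhoods; its Frobenius norm bounds the squares of the eigenvalues.\<close>

lemma eigenvalue_power4_le:
  assumes AB: "A \<union> B = {..<n}" "A \<inter> B = {}" and E: "\<forall>p\<in>E. \<exists>a\<in>A. \<exists>b\<in>B. p = {a, b}"
    and k: "k \<in> spectrum (adjacency_matrix n E)"
  shows "k ^ 4 \<le> (\<Sum>i\<in>A. \<Sum>j\<in>A. (real (card (nbrs n E i \<inter> nbrs n E j)))\<^sup>2)"
proof (cases "k = 0")
  case True
  thus ?thesis by (simp add: sum_nonneg)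
next
  case False
  obtain x where x: "\<exists>i<n. x i \<noteq> 0"
    and eq: "\<And>i. i < n \<Longrightarrow> (\<Sum>j\<in>nbrs n E i. x j) = k * x i"
    using k unfolding spectrum_adjacency_matrix_iff nbrs_def by blast
  have fin: "finite A" using AB(1) by (metis finite_Un finite_lessThan)
  have less: "i < n" if "i \<in> A \<or> i \<in> B" for i using that AB(1) by blast
  note edge = bipartite_edge_cases[OF E]
  have nbrs_A: "nbrs n E i \<subseteq> B" if "i \<in> A" for i
  proof
    fix j assume "j \<in> nbrs n E i"
    hence "{i, j} \<in> E" by (simp add: nbrs_def)
    from edge[OF this] show "j \<in> B" using that AB(2) by blast
  qed
  have nbrs_B: "nbrs n E j = {i \<in> A. j \<in> nbrs n E i}" if "j \<in> B" for j
  proof -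
    have "i < n \<longleftrightarrow> i \<in> A" if "{j, i} \<in> E" for i
      using edge[OF that] \<open>j \<in> B\<close> AB(2) less by blast
    thus ?thesis using that less by (auto simp: nbrs_def insert_commute)
  qed
  have x_B: "k * x j = (\<Sum>i | i \<in> A \<and> j \<in> nbrs n E i. x i)" if "j \<in> B" for j
    using eq[of j] that less by (simp add: nbrs_B)
  have square: "k\<^sup>2 * x i = (\<Sum>l\<in>A. real (card (nbrs n E i \<inter> nbrs n E l)) * x l)" if i: "i \<in> A" for i
  proof -
    have "k\<^sup>2 * x i = (\<Sum>j\<in>nbrs n E i. k * x j)"
      using eq[of i] i less by (simp add: power2_eq_square flip: sum_distrib_left)
    also have "\<dots> = (\<Sum>j\<in>nbrs n E i. \<Sum>l | l \<in> A \<and> j \<in> nbrs n E l. x l)"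
      by (intro sum.cong refl x_B) (use nbrs_A[OF i] in blast)
    also have "\<dots> = (\<Sum>l\<in>A. \<Sum>j | j \<in> nbrs n E i \<and> j \<in> nbrs n E l. x l)"
      by (rule sum.swap_restrict) (use fin in simp_all)
    also have "\<dots> = (\<Sum>l\<in>A. real (card (nbrs n E i \<inter> nbrs n E l)) * x l)"
      by (simp add: Int_def)
    finally show ?thesis .
  qed
  define s where "s = (\<Sum>i\<in>A. (x i)\<^sup>2)"
  \<comment> \<open>If \<open>x\<close> vanished on \<open>A\<close>, the equations at
    \<open>B\<close> would give \<open>k * x j = 0\<close>, and \<open>k \<noteq> 0\<close> would
    make \<open>x\<close> zero everywhere.\<close>
  have "s \<noteq> 0"
  proof
    assume "s = 0"
    hence A0: "x i = 0" if "i \<in> A" for i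
      using that fin by (simp add: s_def sum_nonneg_eq_0_iff)
    hence "x j = 0" if "j \<in> B" for j
      using x_B[OF that] False by simp
    thus False using x A0 AB(1) by (metis UnE lessThan_iff)
  qed
  hence "s > 0" by (simp add: s_def sum_nonneg less_le)
  have "k ^ 4 * s = (\<Sum>i\<in>A. (k\<^sup>2 * x i)\<^sup>2)"
    by (simp add: s_def sum_distrib_left power_mult_distrib flip: power_mult)
  also have "\<dots> \<le> (\<Sum>i\<in>A. (\<Sum>j\<in>A. (real (card (nbrs n E i \<inter> nbrs n E j)))\<^sup>2) * s)"
    by (intro sum_mono) (simp add: square s_def Cauchy_Schwarz_ineq_sum)
  also have "\<dots> = (\<Sum>i\<in>A. \<Sum>j\<in>A. (real (card (nbrs n E i \<inter> nbrs n E j)))\<^sup>2) * s"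
    by (simp add: sum_distrib_right)
  finally show ?thesis using \<open>s > 0\<close> by simp
qed

text \<open>Disjoint sides let an edge determine its orientation, so edges can be counted as ordered
  pairs.\<close>

lemma card_doubletons:
  assumes "P \<inter> Q = {}" "R \<subseteq> P \<times> Q"
  shows "card ((\<lambda>(a, b). {a, b}) ` R) = card R"
proof (rule card_image, rule inj_onI, clarify)
  fix a b c d
  assume "(a, b) \<in> R" "(c, d) \<in> R" "{a, b} = {c, d}"
  thus "a = c \<and> b = d"
    using assms unfolding doubleton_eq_iff by blast
qed

lemma eigenvalue_power4_le_or_factor:
  assumes G: "bipartite n E" "\<not> complete_bipartite_with_isolated n E" and "card E = e" "e > 0"
    and k: "k \<in> spectrum (adjacency_matrix n E)"
  shows "k ^ 4 \<le> (real e)\<^sup>2 - 2 * (real e - 2) \<or>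
    (\<exists>p q. p \<ge> 2 \<and> q \<ge> 2 \<and> (p * q = int e + 1 \<or> p * q = int e - 1))"
proof -
  obtain A B where AB: "A \<union> B = {..<n}" "A \<inter> B = {}"
    and E: "\<forall>p\<in>E. \<exists>a\<in>A. \<exists>b\<in>B. p = {a, b}"
    using G(1) unfolding bipartite_def by blast
  define N where "N = nbrs n E"
  \<comment> \<open>Empty rows are dropped since the Gram bounds concern nonempty sets; they
    contribute nothing to the sums.\<close>
  define I where "I = {i \<in> A. N i \<noteq> {}}"
  have "finite A" using AB(1) by (metis finite_Un finite_lessThan)
  hence fin: "finite I" by (simp add: I_def)
  have N_iff: "b \<in> N a \<longleftrightarrow> {a, b} \<in> E" for a b
    using bipartite_edge_cases[OF E, of a b] AB(1) by (auto simp: N_def nbrs_def)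
  have N_B: "N i \<subseteq> B" if "i \<in> A" for i
    using bipartite_edge_cases[OF E, of i] that AB(2) unfolding N_iff subset_iff by blast
  have E_eq: "E = (\<lambda>(a, b). {a, b}) ` (SIGMA i:I. N i)"
  proof (intro equalityI subsetI)
    fix p assume "p \<in> E"
    then obtain a b where ab: "a \<in> A" "p = {a, b}" using E by blast
    hence "b \<in> N a" using \<open>p \<in> E\<close> by (simp add: N_iff)
    hence "(a, b) \<in> (SIGMA i:I. N i)" using ab(1) by (auto simp: I_def)
    thus "p \<in> (\<lambda>(a, b). {a, b}) ` (SIGMA i:I. N i)" using ab(2) by force
  qed (auto simp: N_iff)
  have "e = card (SIGMA i:I. N i)"
    unfolding \<open>card E = e\<close>[symmetric] E_eq
    by (rule card_doubletons[OF AB(2)]) (use N_B in \<open>auto simp: I_def\<close>)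
  hence e: "e = (\<Sum>i\<in>I. card (N i))" by (simp add: fin N_def)
  have "I \<noteq> {}" using e \<open>e > 0\<close> by auto
  then obtain u where u: "u \<in> I" by blast
  have "\<exists>v\<in>I. N u \<noteq> N v"
  proof (rule ccontr)
    assume "\<not> ?thesis"
    hence "(SIGMA i:I. N i) = I \<times> N u" by auto
    hence "E = {{a, b} | a b. a \<in> I \<and> b \<in> N u}" unfolding E_eq by auto
    moreover have "I \<union> N u \<subseteq> {..<n}" "I \<inter> N u = {}" "N u \<noteq> {}"
      using AB N_B[of u] u by (auto simp: I_def)
    ultimately show False
      using G(2) \<open>I \<noteq> {}\<close> unfolding complete_bipartite_with_isolated_def by blast
  qed
  then obtain v where v: "v \<in> I" "N u \<noteq> N v" by blast
  have "gram_sum N I \<ge> 2 * (int e - 2) \<or>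
      (\<exists>p q. p \<ge> 2 \<and> q \<ge> 2 \<and> (p * q = int e + 1 \<or> p * q = int e - 1))"
    unfolding e by (rule gram_sum_ge[OF fin _ u v]) (auto simp: I_def N_def)
  moreover have "k ^ 4 \<le> (real e)\<^sup>2 - 2 * (real e - 2)" if *: "gram_sum N I \<ge> 2 * (int e - 2)"
  proof -
    have "k ^ 4 \<le> (\<Sum>i\<in>A. \<Sum>j\<in>A. (real (card (N i \<inter> N j)))\<^sup>2)"
      unfolding N_def by (rule eigenvalue_power4_le[OF AB E k])
    also have "\<dots> = (\<Sum>i\<in>A. \<Sum>j\<in>I. (real (card (N i \<inter> N j)))\<^sup>2)"
      by (intro sum.cong refl sum.mono_neutral_right) (use \<open>finite A\<close> in \<open>auto simp: I_def\<close>)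
    also have "\<dots> = (\<Sum>i\<in>I. \<Sum>j\<in>I. (real (card (N i \<inter> N j)))\<^sup>2)"
      by (intro sum.mono_neutral_right) (use \<open>finite A\<close> in \<open>auto simp: I_def\<close>)
    \<comment> \<open>Each squared intersection is a product of row sizes minus a Gram determinant,
      and the products sum to the square of \<open>e\<close>.\<close>
    also have "\<dots> = (\<Sum>i\<in>I. \<Sum>j\<in>I. real (card (N i)) * real (card (N j))) - of_int (gram_sum N I)"
      by (simp add: gram_sum_def gram_def sum_subtractf)
    also have "(\<Sum>i\<in>I. \<Sum>j\<in>I. real (card (N i)) * real (card (N j))) = (real e)\<^sup>2"
      by (simp add: e power2_eq_square sum_product)
    finally have "k ^ 4 \<le> (real e)\<^sup>2 - of_int (gram_sum N I)" .
    moreover have "of_int (gram_sum N I) \<ge> (of_int (2 * (int e - 2)) :: real)"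
      using * by (simp only: of_int_le_iff)
    ultimately show ?thesis by simp
  qed
  ultimately show ?thesis by blast
qed

subsection \<open>Blow-ups of the path on four vertices\<close>

text \<open>Writing \<open>C \<times> B\<close> for the middle edges orients every pair from
  \<open>A \<union> C\<close> to \<open>B \<union> D\<close>, as \<open>card_doubletons\<close>
  requires.\<close>

definition path_blowup :: "nat set \<Rightarrow> nat set \<Rightarrow> nat set \<Rightarrow> nat set \<Rightarrow> nat set set" where
  "path_blowup A B C D = (\<lambda>(u, v). {u, v}) ` (A \<times> B \<union> C \<times> B \<union> C \<times> D)"

context
  fixes A B C D :: "nat set" and n :: nat
  assumes parts: "A \<union> B \<union> C \<union> D = {..<n}"
    and disj: "A \<inter> B = {}" "A \<inter> C = {}" "A \<inter> D = {}" "B \<inter> C = {}" "B \<inter> D = {}" "C \<inter> D = {}"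
    and nonempty: "A \<noteq> {}" "B \<noteq> {}" "C \<noteq> {}" "D \<noteq> {}"
begin

lemma finite_parts: "finite A" "finite B" "finite C" "finite D"
  using parts by (metis finite_Un finite_lessThan)+

lemma path_blowup_iff:
  "{u, v} \<in> path_blowup A B C D \<longleftrightarrow> (u, v) \<in> A \<times> B \<union> C \<times> B \<union> C \<times> D \<or> (v, u) \<in> A \<times> B \<union> C \<times> B \<union> C \<times> D"
  by (auto simp: path_blowup_def doubleton_eq_iff image_iff Bex_def)

lemma simple_graph_path_blowup: "simple_graph n (path_blowup A B C D)"
  unfolding simple_graph_def
proof
  fix p assume "p \<in> path_blowup A B C D"
  then obtain u v where p: "p = {u, v}" "(u, v) \<in> A \<times> B \<union> C \<times> B \<union> C \<times> D"
    by (auto simp: path_blowup_def)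
  hence "u \<noteq> v" using disj by blast
  moreover have "{u, v} \<subseteq> {..<n}" unfolding parts[symmetric] using p(2) by blast
  ultimately show "p \<subseteq> {..<n} \<and> card p = 2" by (simp add: p(1))
qed

lemma bipartite_path_blowup: "bipartite n (path_blowup A B C D)"
  unfolding bipartite_def
proof (intro exI conjI)
  show "(A \<union> C) \<union> (B \<union> D) = {..<n}" using parts by blast
  show "(A \<union> C) \<inter> (B \<union> D) = {}" using disj by blast
qed (auto simp: path_blowup_def)

lemma card_path_blowup:
  "card (path_blowup A B C D) = card A * card B + card B * card C + card C * card D"
proof -
  have "card (path_blowup A B C D) = card (A \<times> B \<union> C \<times> B \<union> C \<times> D)"
    unfolding path_blowup_def
    by (rule card_doubletons[of "A \<union> C" "B \<union> D"]) (use disj in blast)+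
  also have "\<dots> = card (A \<times> B \<union> C \<times> B) + card (C \<times> D)"
    by (rule card_Un_disjoint) (use disj finite_parts in auto)
  also have "card (A \<times> B \<union> C \<times> B) = card (A \<times> B) + card (C \<times> B)"
    by (rule card_Un_disjoint) (use disj finite_parts in auto)
  finally show ?thesis by (simp add: card_cartesian_product mult.commute)
qed

text \<open>In a complete bipartite graph the ends of a path with three edges are adjacent, but no
  edge joins \<open>A\<close> to \<open>D\<close>.\<close>

lemma not_complete_path_blowup: "\<not> complete_bipartite_with_isolated n (path_blowup A B C D)"
proof
  assume "complete_bipartite_with_isolated n (path_blowup A B C D)"
  then obtain X Y where XY: "X \<inter> Y = {}" "path_blowup A B C D = {{a, b} | a b. a \<in> X \<and> b \<in> Y}"
    unfolding complete_bipartite_with_isolated_def by (elim exE conjE) (rule that)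
  obtain a b c d where abcd: "a \<in> A" "b \<in> B" "c \<in> C" "d \<in> D"
    using nonempty by (meson ex_in_conv)
  have iff: "{u, v} \<in> path_blowup A B C D \<longleftrightarrow> u \<in> X \<and> v \<in> Y \<or> v \<in> X \<and> u \<in> Y" for u v
    unfolding XY(2) by (auto simp: doubleton_eq_iff)
  have "{a, b} \<in> path_blowup A B C D" "{c, b} \<in> path_blowup A B C D" "{c, d} \<in> path_blowup A B C D"
    using abcd by (auto simp: path_blowup_iff)
  hence "{a, d} \<in> path_blowup A B C D" using XY(1) unfolding iff by blast
  thus False using abcd disj unfolding path_blowup_iff by blast
qed

text \<open>The eigenvector is constant on each part. Its values are chosen to satisfy the equations
  at \<open>A\<close>, \<open>B\<close> and \<open>D\<close>; the equation at \<open>C\<close> is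
  then the assumption \<open>k\<close>, the characteristic equation of the quotient.\<close>

lemma path_blowup_eigenvalue:
  fixes k :: real
  defines "a \<equiv> real (card A)" and "b \<equiv> real (card B)" and "c \<equiv> real (card C)" and "d \<equiv> real (card D)"
  assumes "k \<noteq> 0" and k: "(k\<^sup>2 - a * b) * (k\<^sup>2 - c * d) = k\<^sup>2 * (b * c)"
  shows "k \<in> spectrum (adjacency_matrix n (path_blowup A B C D))"
proof -
  define x where "x i = (if i \<in> A then b * c else if i \<in> B then k * c else
    if i \<in> C then k\<^sup>2 - a * b else c * (k\<^sup>2 - a * b) / k)" for i
  have sums: "(\<Sum>j\<in>A. x j) = a * (b * c)" "(\<Sum>j\<in>B. x j) = b * (k * c)"
    "(\<Sum>j\<in>C. x j) = c * (k\<^sup>2 - a * b)" "(\<Sum>j\<in>D. x j) = d * (c * (k\<^sup>2 - a * b) / k)"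
  proof -
    have "(\<Sum>j\<in>A. x j) = (\<Sum>j\<in>A. b * c)" by (intro sum.cong) (auto simp: x_def)
    moreover have "(\<Sum>j\<in>B. x j) = (\<Sum>j\<in>B. k * c)"
      by (intro sum.cong) (use disj in \<open>auto simp: x_def\<close>)
    moreover have "(\<Sum>j\<in>C. x j) = (\<Sum>j\<in>C. k\<^sup>2 - a * b)"
      by (intro sum.cong) (use disj in \<open>auto simp: x_def\<close>)
    moreover have "(\<Sum>j\<in>D. x j) = (\<Sum>j\<in>D. c * (k\<^sup>2 - a * b) / k)"
      by (intro sum.cong) (use disj in \<open>auto simp: x_def\<close>)
    ultimately show "(\<Sum>j\<in>A. x j) = a * (b * c)" "(\<Sum>j\<in>B. x j) = b * (k * c)"
      "(\<Sum>j\<in>C. x j) = c * (k\<^sup>2 - a * b)" "(\<Sum>j\<in>D. x j) = d * (c * (k\<^sup>2 - a * b) / k)"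
      by (simp_all add: a_def b_def c_def d_def)
  qed
  let ?N = "\<lambda>i. {j. j < n \<and> {i, j} \<in> path_blowup A B C D}"
  have eq: "(\<Sum>j\<in>?N i. x j) = k * x i" if "i < n" for i
  proof -
    have less: "j < n" if "j \<in> A \<union> B \<union> C \<union> D" for j using that parts by blast
    consider "i \<in> A" | "i \<in> B" | "i \<in> C" | "i \<in> D" using \<open>i < n\<close> parts by blast
    thus ?thesis
    proof cases
      case 1
      hence "?N i = B" using disj less unfolding path_blowup_iff by blast
      thus ?thesis using 1 by (simp only: sums) (simp add: x_def)
    next
      case 2
      hence "?N i = A \<union> C" using disj less unfolding path_blowup_iff by blast
      hence "(\<Sum>j\<in>?N i. x j) = a * (b * c) + c * (k\<^sup>2 - a * b)"
        using finite_parts disj by (simp only: sum.union_disjoint sums)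
      moreover have "i \<notin> A" using 2 disj by blast
      ultimately show ?thesis using 2 by (simp add: x_def algebra_simps power2_eq_square)
    next
      case 3
      hence "?N i = B \<union> D" using disj less unfolding path_blowup_iff by blast
      hence "(\<Sum>j\<in>?N i. x j) = b * (k * c) + d * (c * (k\<^sup>2 - a * b) / k)"
        using finite_parts disj by (simp only: sum.union_disjoint sums)
      also have "\<dots> = (k\<^sup>2 * (b * c) + c * d * (k\<^sup>2 - a * b)) / k"
        using \<open>k \<noteq> 0\<close> by (simp add: field_simps power2_eq_square)
      also have "k\<^sup>2 * (b * c) + c * d * (k\<^sup>2 - a * b) = k\<^sup>2 * (k\<^sup>2 - a * b)"
        unfolding k[symmetric] by (simp add: algebra_simps)
      finally have "(\<Sum>j\<in>?N i. x j) = k * (k\<^sup>2 - a * b)" by (simp add: power2_eq_square)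
      moreover have "i \<notin> A" "i \<notin> B" using 3 disj by blast+
      ultimately show ?thesis using 3 by (simp add: x_def)
    next
      case 4
      hence "?N i = C" using disj less unfolding path_blowup_iff by blast
      moreover have "i \<notin> A" "i \<notin> B" "i \<notin> C" using 4 disj by blast+
      ultimately show ?thesis using \<open>k \<noteq> 0\<close> by (simp only: sums) (simp add: x_def)
    qed
  qed
  obtain i where "i \<in> A" using nonempty by blast
  hence "i < n" "x i \<noteq> 0"
    using parts nonempty finite_parts by (auto simp: x_def b_def c_def)
  thus ?thesis unfolding spectrum_adjacency_matrix_iff using eq by blast
qed

end

text \<open>Expanding the characteristic equation in \<open>t = k^2\<close> gives
  \<open>t^2 - e * t + a * b * c * d = 0\<close>; its larger root \<open>t\<close> provides the
  eigenvalue \<open>sqrt t\<close>.\<close>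

lemma path_blowup_radius:
  fixes a b c d :: nat
  assumes pos: "a > 0" "b > 0" "c > 0" "d > 0"
    and e: "e = a * b + b * c + c * d"
  shows "\<exists>r\<in>radii e. sqrt ((real e + sqrt ((real e)\<^sup>2 - 4 * real (a * b * c * d))) / 2) \<le> r"
proof -
  define A B C D where "A = {..<a}" and "B = {a..<a + b}" and "C = {a + b..<a + b + c}"
    and "D = {a + b + c..<a + b + c + d}"
  define n where "n = a + b + c + d"
  have ABCD: "A \<union> B \<union> C \<union> D = {..<n}"
    "A \<inter> B = {}" "A \<inter> C = {}" "A \<inter> D = {}" "B \<inter> C = {}" "B \<inter> D = {}" "C \<inter> D = {}"
    "A \<noteq> {}" "B \<noteq> {}" "C \<noteq> {}" "D \<noteq> {}"
    using pos by (auto simp: A_def B_def C_def D_def n_def)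
  have card: "card A = a" "card B = b" "card C = c" "card D = d"
    by (simp_all add: A_def B_def C_def D_def)
  define G where "G = path_blowup A B C D"
  have "card G = e"
    unfolding G_def card_path_blowup[OF ABCD] card e ..
  hence in_radii: "graph_spectral_radius n G \<in> radii e"
    unfolding radii_def using simple_graph_path_blowup[OF ABCD] bipartite_path_blowup[OF ABCD]
      not_complete_path_blowup[OF ABCD] by (auto simp: G_def)
  define S where "S = real (a * b * c * d)"
  define t where "t = (real e + sqrt ((real e)\<^sup>2 - 4 * S)) / 2"
  \<comment> \<open>The discriminant is nonnegative, by the inequality of arithmetic and geometric
    means for \<open>a * b\<close> and \<open>c * d\<close>.\<close>
  have "4 * S \<le> (real (a * b) + real (c * d))\<^sup>2"
    using sum_squares_ge_zero[of "real (a * b) - real (c * d)" 0]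
    by (simp add: S_def power2_eq_square algebra_simps)
  also have "\<dots> \<le> (real e)\<^sup>2"
    by (rule power_mono) (simp_all add: e)
  finally have S_le: "4 * S \<le> (real e)\<^sup>2" .
  hence "(sqrt ((real e)\<^sup>2 - 4 * S))\<^sup>2 = (real e)\<^sup>2 - 4 * S" by simp
  hence t_root: "t\<^sup>2 - real e * t + S = 0"
    by (simp add: t_def field_simps power2_eq_square)
  have "e > 0" using pos by (simp add: e)
  hence "t > 0" using S_le by (simp add: t_def add_pos_nonneg)
  have "sqrt t \<in> spectrum (adjacency_matrix n G)"
    unfolding G_def
  proof (rule path_blowup_eigenvalue[OF ABCD], unfold card)
    show "sqrt t \<noteq> 0" using \<open>t > 0\<close> by simp
    have "(t - real a * real b) * (t - real c * real d) - t * (real b * real c) = t\<^sup>2 - real e * t + S"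
      by (simp add: e S_def power2_eq_square algebra_simps)
    thus "((sqrt t)\<^sup>2 - real a * real b) * ((sqrt t)\<^sup>2 - real c * real d) = (sqrt t)\<^sup>2 * (real b * real c)"
      using t_root \<open>t > 0\<close> by simp
  qed
  hence "sqrt t \<le> graph_spectral_radius n G"
    unfolding graph_spectral_radius_def by (intro Max_ge) simp_all
  thus ?thesis using in_radii unfolding t_def S_def by blast
qed

section \<open>Comparison with the threshold\<close>

lemma threshold_le:
  fixes e s c :: real
  assumes "s \<le> c"
  shows "sqrt ((e + sqrt (e\<^sup>2 - 4 * c)) / 2) \<le> sqrt ((e + sqrt (e\<^sup>2 - 4 * s)) / 2)"
  using assms by simp

text \<open>The threshold is \<open>sqrt T\<close>, and \<open>T^2 = e^2 - 2 * c - d^2\<close>.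
  Comparing with the bound on \<open>k^4\<close> leaves \<open>2 * r > 2 + d^2\<close>, which
  follows from \<open>r > 3 / 2\<close> and \<open>d^2 < 1\<close>.\<close>

lemma less_threshold:
  fixes e k :: real
  assumes "e \<ge> 4" and k: "k ^ 4 \<le> e\<^sup>2 - 2 * (e - 2)"
  shows "k < sqrt ((e + sqrt (e\<^sup>2 - 4 * (e - 1 - sqrt (e - 1)))) / 2)"
proof -
  define r where "r = sqrt (e - 1)"
  define c where "c = e - 1 - r"
  define D where "D = sqrt (e\<^sup>2 - 4 * c)"
  define T where "T = (e + D) / 2"
  define d where "d = (e - D) / 2"
    \<comment> \<open>\<open>T\<close> and \<open>d\<close> are the roots of \<open>X\<^sup>2 - e X + c\<close>\<close>
  have "r > 3 / 2"
    unfolding r_def using assms(1) by (intro real_less_rsqrt) (simp add: power2_eq_square)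
  have r2: "r\<^sup>2 = e - 1" using assms(1) by (simp add: r_def)
  have "c = r * (r - 1)" using r2 by (simp add: c_def power2_eq_square algebra_simps)
  hence "c > 0" using \<open>r > 3 / 2\<close> by simp
  have sq: "e\<^sup>2 - 4 * c = (e - 2)\<^sup>2 + 4 * r"
    by (simp add: c_def power2_eq_square algebra_simps)
  hence D2: "D\<^sup>2 = e\<^sup>2 - 4 * c" using \<open>r > 3 / 2\<close> by (simp add: D_def)
  have "D > e - 2"
    unfolding D_def using sq \<open>r > 3 / 2\<close> by (intro real_less_rsqrt) simp
  have "D < e"
    unfolding D_def using \<open>c > 0\<close> assms(1) by (intro real_less_lsqrt) simp_all
  have "\<bar>d\<bar> < 1" using \<open>D > e - 2\<close> \<open>D < e\<close> by (simp add: d_def)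
  hence "d\<^sup>2 < 1" by (simp add: abs_square_less_1)
  moreover have "T\<^sup>2 = e\<^sup>2 - d\<^sup>2 - 2 * c"
    using D2 by (simp add: T_def d_def power2_eq_square field_simps)
  ultimately have "T\<^sup>2 > e\<^sup>2 - 2 * (e - 2)"
    using \<open>r > 3 / 2\<close> by (simp add: c_def)
  hence "(k\<^sup>2)\<^sup>2 < T\<^sup>2" using k by (simp flip: power_mult)
  moreover have "T \<ge> 0" using \<open>D > e - 2\<close> assms(1) by (simp add: T_def)
  ultimately have "k\<^sup>2 < T" by (rule power2_less_imp_less)
  thus ?thesis unfolding T_def D_def c_def r_def by (rule real_less_rsqrt)
qed

section \<open>Factorizations and the equivalence\<close>

lemma not_prime_obtain_factors:
  fixes m :: nat
  assumes "\<not> prime m" "m \<ge> 2"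
  obtains p q where "m = p * q" "p \<ge> q" "q \<ge> 2"
proof -
  obtain p q where pq: "m = p * q" "p \<noteq> 1" "q \<noteq> 1"
    using assms by (auto simp: prime_nat_iff)
  have "p * q \<noteq> 0" using pq(1) assms(2) by linarith
  hence "p \<ge> 2" "q \<ge> 2" using pq(2,3) by auto
  thus ?thesis using that[of p q] that[of q p] pq(1) by (cases "p \<ge> q") (auto simp: mult.commute)
qed

lemma prime_no_factors:
  fixes p q :: int
  assumes "prime (m :: nat)" "p \<ge> 2" "q \<ge> 2"
  shows "p * q \<noteq> int m"
proof
  assume "p * q = int m"
  hence "nat p * nat q = m" using assms(2) by (metis nat_int nat_mult_distrib order_trans zero_le_numeral)
  hence "nat p = 1 \<or> nat q = 1" using assms(1) by (metis prime_product)
  thus False using assms(2,3) by auto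
qed

theorem theorem5p2:
  fixes e :: nat
  assumes "e \<ge> 4"
  shows "prime (e - 1) \<and> prime (e + 1) \<longleftrightarrow>
    max_spectral_radius e <
      sqrt ((real e + sqrt ((real e)^2 - 4 * (real e - 1 - sqrt (real e - 1)))) / 2)"
    (is "_ \<longleftrightarrow> _ < ?t")
proof
  assume primes: "prime (e - 1) \<and> prime (e + 1)"
  \<comment> \<open>The blow-up with part sizes 1, 1, 1, \<open>e - 2\<close> is a witness, so the
    maximum is attained.\<close>
  have "radii e \<noteq> {}"
  proof -
    have "e = 1 * 1 + 1 * 1 + 1 * (e - 2)" using assms by simp
    from path_blowup_radius[OF _ _ _ _ this] show ?thesis using assms by auto
  qed
  hence "max_spectral_radius e \<in> radii e"
    unfolding max_spectral_radius_def radii_def[symmetric]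
    using finite_radii assms by (intro Max_in) simp_all
  then obtain n E where E: "simple_graph n E" "bipartite n E" "card E = e"
      "\<not> complete_bipartite_with_isolated n E" "max_spectral_radius e = graph_spectral_radius n E"
    unfolding radii_def by blast
  have "E \<noteq> {}" using E(3) assms by auto
  hence "max_spectral_radius e \<in> spectrum (adjacency_matrix n E)"
    using graph_spectral_radius_in_spectrum simple_graph_pos E(1,5) by simp
  moreover have "p * q \<noteq> int e + 1 \<and> p * q \<noteq> int e - 1" if "p \<ge> 2" "q \<ge> 2" for p q
    using primes prime_no_factors[OF _ that, of "e - 1"] prime_no_factors[OF _ that, of "e + 1"] assms
    by (simp add: of_nat_diff add.commute)
  ultimately have "max_spectral_radius e ^ 4 \<le> (real e)\<^sup>2 - 2 * (real e - 2)"
    using eigenvalue_power4_le_or_factor[OF E(2,4,3)] assms by fastforce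
  thus "max_spectral_radius e < ?t" using assms by (intro less_threshold) simp_all
next
  assume less: "max_spectral_radius e < ?t"
  \<comment> \<open>A path blow-up with so small a product has an eigenvalue at or above the
    threshold.\<close>
  have small: False
    if pos: "a > 0" "b > 0" "c > 0" "d > 0" and e: "e = a * b + b * c + c * d"
      and S: "real (a * b * c * d) \<le> real e - 1 - sqrt (real e - 1)" for a b c d
  proof -
    obtain r where r: "r \<in> radii e"
        "sqrt ((real e + sqrt ((real e)\<^sup>2 - 4 * real (a * b * c * d))) / 2) \<le> r"
      using path_blowup_radius[OF pos e] by blast
    have "r \<le> max_spectral_radius e"
      unfolding max_spectral_radius_def radii_def[symmetric]
      using finite_radii assms r(1) by (intro Max_ge) simp_all
    thus False using r(2) threshold_le[OF S, of "real e"] less by linarith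
  qed
  show "prime (e - 1) \<and> prime (e + 1)"
  proof (rule conjI; rule ccontr)
    assume "\<not> prime (e - 1)"
    then obtain p q where pq: "e - 1 = p * q" "p \<ge> q" "q \<ge> 2"
      by (rule not_prime_obtain_factors) (use assms in simp)
    \<comment> \<open>The part sizes will be 1, 1, \<open>p\<close>, \<open>w\<close>. Their product
      is \<open>e - 1 - p\<close>, so \<open>sqrt (e - 1) \<le> p\<close> suffices, which holds
      because \<open>p\<close> is the larger factor.\<close>
    define w where "w = q - 1"
    have w: "q = w + 1" "w > 0" using pq(3) by (simp_all add: w_def)
    have e: "e = p * w + p + 1" using pq(1) assms by (simp add: w(1))
    have "p * q \<le> p * p" using pq(2) by (rule mult_le_mono2)
    hence "e - 1 \<le> p\<^sup>2" unfolding pq(1) power2_eq_square .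
    hence "real (e - 1) \<le> (real p)\<^sup>2" by (simp only: of_nat_le_iff flip: of_nat_power)
    hence "sqrt (real e - 1) \<le> real p"
      using assms by (intro real_le_lsqrt) (simp_all add: of_nat_diff)
    thus False
      \<comment> \<open>the complete bipartite graph with parts of size \<open>p\<close> and \<open>q\<close>, plus a pendant edge\<close>
      using pq(2,3) w(2) by (intro small[of 1 1 p w]) (simp_all add: e)
  next
    assume "\<not> prime (e + 1)"
    then obtain p q where pq: "e + 1 = p * q" "p \<ge> q" "q \<ge> 2"
      by (rule not_prime_obtain_factors) (use assms in simp)
    \<comment> \<open>The part sizes will be 1, \<open>s + 1\<close>, \<open>t + 1\<close>, 1, with
      product \<open>e - 1 - (s + t + 1)\<close>; so \<open>e - 1 \<le> (s + t + 1)^2\<close> is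
      needed.\<close>
    define s t where "s = p - 2" and "t = q - 2"
    have st: "p = s + 2" "q = t + 2" using pq(2,3) by (simp_all add: s_def t_def)
    have e: "e = s * t + 2 * s + 2 * t + 3"
      using pq(1) by (simp add: st algebra_simps)
    \<comment> \<open>If \<open>s = 0\<close>, then \<open>p = q = 2\<close> and
      \<open>e = 3\<close>, against \<open>e \<ge> 4\<close>.\<close>
    have "s \<ge> 1" using assms pq(2) by (cases s) (auto simp: e st)
    hence "1 \<le> s * s + s * t + t * t" using le_square[of s] by linarith
    hence "e - 1 \<le> (s + t + 1)\<^sup>2" by (simp add: e power2_eq_square algebra_simps)
    hence "real (e - 1) \<le> (real (s + t + 1))\<^sup>2" by (simp only: of_nat_le_iff flip: of_nat_power)
    hence "sqrt (real e - 1) \<le> real (s + t + 1)"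
      using assms by (intro real_le_lsqrt) (simp_all add: of_nat_diff)
    thus False
      \<comment> \<open>the complete bipartite graph with parts of size \<open>p\<close> and \<open>q\<close>, minus an edge\<close>
      by (intro small[of 1 "s + 1" "t + 1" 1]) (simp_all add: e algebra_simps)
  qed
qed

end
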